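(* Let $K_1,K_2$ be real numbers with $K_1=-K_2<0$, and let $\Theta(t)=(\theta_1(t),\theta_2(t),\theta_3(t))$, $t\ge 0$, be the solution, with initial data $\Theta(0)\in\mathbb{R}^3$, of the system $$\left\{\begin{aligned} \dot{\theta}_1(t)&=\tfrac{K_2}{3}\sin(\theta_3(t)-\theta_1(t))+\tfrac{K_1}{3}\sin(\theta_2(t)-\theta_1(t))\\ \dot{\theta}_2(t)&=\tfrac{K_2}{3}\sin(\theta_3(t)-\theta_2(t))+\tfrac{K_1}{3}\sin(\theta_1(t)-\theta_2(t))\\ \dot{\theta}_3(t)&=\tfrac{K_2}{3}\sin(\theta_1(t)-\theta_3(t))+\tfrac{K_2}{3}\sin(\theta_2(t)-\theta_3(t)). \end{aligned}\right.$$ (1) If $$-\pi<\theta_1(0)-\theta_3(0)<\tfrac{\pi}{3},\quad -\tfrac{\pi}{3}<\theta_2(0)-\theta_3(0)<\pi,\quad -\tfrac{4\pi}{3}<\theta_1(0)-\theta_2(0)<0,$$ then $\Theta(t)$ converges exponentially fast to the synchronization mode $\Theta^*_5=(0,\frac{2\pi}{3},\frac{\pi}{3})$. (2) If $$-\tfrac{7\pi}{3}<\theta_1(0)-\theta_3(0)<-\pi,\quad -\pi<\theta_2(0)-\theta_3(0)<\tfrac{\pi}{3},\quad -2\pi<\theta_1(0)-\theta_2(0)<-\tfrac{2\pi}{3},$$ then $\Theta(t)$ converges exponentially fast to the synchronization mode $\Theta^*_6=(0,\frac{4\pi}{3},\frac{5\pi}{3})$.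
   Context: The system is invariant under the translations $\Theta\mapsto\Theta+c(1,1,1)$, $c\in\mathbb{R}$, and a synchronization mode is understood modulo such translations. Thus "$\Theta(t)$ converges exponentially fast to the synchronization mode $\Theta^*=(\theta_1^*,\theta_2^*,\theta_3^* )$" means: there exist constants $C\ge 0$ and $\lambda>0$ such that $|(\theta_i(t)-\theta_j(t))-(\theta_i^*-\theta_j^* )|\le Ce^{-\lambda t}$ for all $i,j\in\{1,2,3\}$ and all $t\ge 0$. *)

theory Defs
  imports "HOL-Analysis.Analysis"
begin

definition kuramoto3_field :: "real \<Rightarrow> real \<Rightarrow> real ^ 3 \<Rightarrow> real ^ 3" where
  "kuramoto3_field K1 K2 \<theta> = vector
     [K2 / 3 * sin (\<theta> $ 3 - \<theta> $ 1) + K1 / 3 * sin (\<theta> $ 2 - \<theta> $ 1),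
      K2 / 3 * sin (\<theta> $ 3 - \<theta> $ 2) + K1 / 3 * sin (\<theta> $ 1 - \<theta> $ 2),
      K2 / 3 * sin (\<theta> $ 1 - \<theta> $ 3) + K2 / 3 * sin (\<theta> $ 2 - \<theta> $ 3)]"

text \<open>The derivative is taken within \<open>{0..}\<close>, so it is one-sided at time 0, and the values of
  \<open>\<Theta>\<close> at negative times are irrelevant.\<close>

definition kuramoto3_solution :: "real \<Rightarrow> real \<Rightarrow> (real \<Rightarrow> real ^ 3) \<Rightarrow> bool" where
  "kuramoto3_solution K1 K2 \<Theta> \<longleftrightarrow>
     (\<forall>t\<ge>0. (\<Theta> has_vector_derivative kuramoto3_field K1 K2 (\<Theta> t)) (at t within {0..}))"

text \<open>Synchronization modes are understood modulo the translations \<open>\<Theta> \<mapsto> \<Theta> + c (1,1,1)\<close>, hence only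
  phase differences are compared. The differences are real numbers, not reduced modulo \<open>2\<pi>\<close>.\<close>

definition converges_exponentially_to_mode :: "(real \<Rightarrow> real ^ 3) \<Rightarrow> real ^ 3 \<Rightarrow> bool" where
  "converges_exponentially_to_mode \<Theta> \<Phi> \<longleftrightarrow>
     (\<exists>C r. C \<ge> 0 \<and> r > 0 \<and>
        (\<forall>i j. \<forall>t\<ge>0. \<bar>(\<Theta> t $ i - \<Theta> t $ j) - (\<Phi> $ i - \<Phi> $ j)\<bar> \<le> C * exp (- r * t)))"

end

theory Submission imports Defs begin

text \<open>
  In both cases suitable affine images \<open>u, v, w\<close> of the phase differences are positive at time 0,
  have sum \<open>2\<pi>\<close>, should tend to \<open>2\<pi>/3\<close>, and satisfy the cyclically symmetric system
  \<open>u' = k (2 sin u - sin v - sin w)\<close> with \<open>k = K2 / 3\<close>. As \<open>v + w = 2\<pi> - u\<close>, this reads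
  \<open>u' = 2 k sin (u/2) (2 cos (u/2) - cos ((v - w)/2))\<close>. Hence \<open>sin (u/2)\<close> solves a linear equation
  and stays positive, and the bound \<open>cos ((v - w)/2) \<le> 1\<close> alone pushes \<open>u\<close> above \<open>2\<pi>/3\<close> up to an
  exponentially small error. The same lower bound for \<open>v\<close> and \<open>w\<close> gives, since the sum is fixed,
  the upper bound for \<open>u\<close>.
\<close>

section \<open>Scalar differential inequalities and barriers\<close>

text \<open>The product \<open>f s * exp (r * s)\<close> has nonpositive derivative. This is applied
  to the negative of a square, where it bounds the square from below, and to a quantity that may
  change sign.\<close>

lemma gronwall_exp_decay:
  fixes f f' :: "real \<Rightarrow> real"
  assumes deriv: "\<And>t. t \<ge> 0 \<Longrightarrow> (f has_real_derivative f' t) (at t within {0..})"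
    and le: "\<And>t. t \<ge> 0 \<Longrightarrow> f' t \<le> - r * f t"
    and "t \<ge> 0"
  shows "f t \<le> f 0 * exp (- r * t)"
proof -
  define g where "g s = f s * exp (r * s)" for s
  define g' where "g' s = (f' s + r * f s) * exp (r * s)" for s
  have "(g has_derivative (*) (g' s)) (at s within {0..t})" if "s \<in> {0..t}" for s
  proof -
    have "(f has_real_derivative f' s) (at s within {0..t})"
      using deriv[of s] that by (auto intro: DERIV_subset)
    then have "(g has_real_derivative g' s) (at s within {0..t})"
      unfolding g_def g'_def
      by (auto intro!: derivative_eq_intros simp: algebra_simps)
    then show ?thesis
      by (simp add: has_field_derivative_def)
  qed
  from mvt_very_simple[of 0 t g "\<lambda>s. (*) (g' s)", OF \<open>t \<ge> 0\<close>] this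
  obtain s where s: "s \<in> {0..t}" "g t - g 0 = g' s * (t - 0)"
    by auto
  have "g' s \<le> 0"
    using le[of s] s(1) by (auto simp: g'_def mult_le_0_iff)
  with s \<open>t \<ge> 0\<close> have "g t \<le> g 0"
    using mult_nonpos_nonneg[of "g' s" t] by simp
  then have "f t * exp (r * t) * exp (- r * t) \<le> f 0 * exp (- r * t)"
    by (simp add: g_def)
  then show ?thesis
    by (simp add: mult.assoc flip: exp_add)
qed

text \<open>Since \<open>(z^2)' = 2 a z^2 >= - 2 M z^2\<close>, the square decays at most like
  \<open>exp (- 2 M t)\<close>. Comparing \<open>- z^2\<close> turns this into an instance of
  \<open>gronwall_exp_decay\<close>.\<close>

lemma linear_ode_nonzero:
  fixes z a :: "real \<Rightarrow> real"
  assumes deriv: "\<And>t. t \<ge> 0 \<Longrightarrow> (z has_real_derivative a t * z t) (at t within {0..})"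
    and bound: "\<And>t. t \<ge> 0 \<Longrightarrow> \<bar>a t\<bar> \<le> M"
    and "z 0 \<noteq> 0" "t \<ge> 0"
  shows "z t \<noteq> 0"
proof -
  have "- (z t)\<^sup>2 \<le> - (z 0)\<^sup>2 * exp (- (2 * M) * t)"
  proof (rule gronwall_exp_decay[where f' = "\<lambda>t. - (2 * z t * (a t * z t))"])
    show "((\<lambda>t. - (z t)\<^sup>2) has_real_derivative - (2 * z s * (a s * z s))) (at s within {0..})"
      if "s \<ge> 0" for s
      using deriv[OF that] by (auto intro!: derivative_eq_intros)
    show "- (2 * z s * (a s * z s)) \<le> - (2 * M) * - (z s)\<^sup>2" if "s \<ge> 0" for s
    proof -
      have "- a s * (z s)\<^sup>2 \<le> M * (z s)\<^sup>2"
        using bound[OF that] by (intro mult_right_mono) auto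
      then show ?thesis
        by (simp add: power2_eq_square algebra_simps)
    qed
  qed fact
  moreover have "(z 0)\<^sup>2 * exp (- (2 * M) * t) > 0"
    using \<open>z 0 \<noteq> 0\<close> by simp
  ultimately show ?thesis
    by auto
qed

lemma continuous_avoiding_stays_between:
  fixes u :: "real \<Rightarrow> real"
  assumes cont: "continuous_on {0..t} u" and "t \<ge> 0"
    and avoid: "\<And>s. 0 \<le> s \<Longrightarrow> s \<le> t \<Longrightarrow> u s \<noteq> a \<and> u s \<noteq> b"
    and "a < u 0" "u 0 < b"
  shows "a < u t \<and> u t < b"
proof (intro conjI; rule ccontr)
  assume "\<not> a < u t"
  then obtain s where "0 \<le> s" "s \<le> t" "u s = a"
    using IVT2'[of u t a 0] assms by auto
  then show False using avoid by blast
next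
  assume "\<not> u t < b"
  then obtain s where "0 \<le> s" "s \<le> t" "u s = b"
    using IVT'[of u 0 b t] assms by auto
  then show False using avoid by blast
qed

section \<open>Lower bound for a single gap\<close>

text \<open>Converts an estimate on \<open>cos (u / 2)\<close> back into one on \<open>u\<close>.
  For \<open>x <= pi / 3\<close> write \<open>cos x - cos (pi / 3)\<close> as a product of sines:
  with \<open>b = (pi / 3 - x) / 2\<close>, one sine is at least \<open>1 / 2\<close> and the other
  at least \<open>b / 2\<close>. Beyond \<open>pi / 3\<close> the left side is negative and the
  \<open>max\<close> takes over.\<close>

lemma cos_minus_half_ge:
  fixes x :: real
  assumes "0 \<le> x" "x \<le> pi"
  shows "(pi / 3 - x) / 4 \<le> max 0 (cos x - 1 / 2)"
proof (cases "x \<le> pi / 3")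
  case True
  define b where "b = (pi / 3 - x) / 2"
  have b: "0 \<le> b" "b \<le> pi / 6"
    using assms True by (auto simp: b_def)
  obtain c where c: "c \<in> {0..b}" "sin b - sin 0 = cos c * (b - 0)"
    using mvt_very_simple[of 0 b sin "\<lambda>s. (*) (cos s)"] b(1)
      has_field_derivative_at_within[OF DERIV_sin]
    unfolding has_field_derivative_def by blast
  have "cos (pi / 3) \<le> cos c"
    using c(1) b by (intro cos_monotone_0_pi_le) auto
  then have "1 / 2 * b \<le> cos c * b"
    using b(1) by (intro mult_right_mono) (auto simp: cos_60)
  then have sin_b: "b / 2 \<le> sin b"
    using c(2) by simp
  have "sin (pi / 6) \<le> sin ((x + pi / 3) / 2)"
    using assms True by (intro sin_monotone_2pi_le) auto
  then have "1 / 2 * (b / 2) \<le> sin ((x + pi / 3) / 2) * sin b"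
    using sin_b b(1) by (intro mult_mono) (auto simp: sin_30)
  moreover have "cos x - cos (pi / 3) = 2 * sin ((x + pi / 3) / 2) * sin b"
    by (simp add: cos_diff_cos b_def)
  ultimately show ?thesis
    by (simp add: cos_60 b_def)
next
  case False
  then have "(pi / 3 - x) / 4 \<le> 0" by simp
  then show ?thesis by (rule order_trans) simp
qed

text \<open>The other two gaps enter only through \<open>b\<close>; keeping nothing of it but the
  bound by 1 decouples the equation for \<open>u\<close>.\<close>

lemma phase_gap_lower_bound:
  fixes u b :: "real \<Rightarrow> real"
  assumes "k > 0"
    and deriv: "\<And>t. t \<ge> 0 \<Longrightarrow>
      (u has_real_derivative 2 * k * sin (u t / 2) * (2 * cos (u t / 2) - b t)) (at t within {0..})"
    and b: "\<And>t. \<bar>b t\<bar> \<le> 1"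
    and u0: "0 < u 0" "u 0 < 2 * pi"
  shows "\<exists>C\<ge>0. \<forall>t\<ge>0. 2 * pi / 3 - C * exp (- (3 / 2 * k) * t) \<le> u t"
proof -
  have cont: "continuous_on {0..} u"
    using deriv by (intro DERIV_continuous_on) auto
  have sin_nz: "sin (u t / 2) \<noteq> 0" if "t \<ge> 0" for t
  proof (rule linear_ode_nonzero[where M = "3 * k" and t = t and z = "\<lambda>t. sin (u t / 2)"
        and a = "\<lambda>t. k * (cos (u t / 2) * (2 * cos (u t / 2) - b t))"])
    show "((\<lambda>t. sin (u t / 2)) has_real_derivative
        k * (cos (u s / 2) * (2 * cos (u s / 2) - b s)) * sin (u s / 2)) (at s within {0..})"
      if "s \<ge> 0" for s
      using deriv[OF that] by (auto intro!: derivative_eq_intros)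
    show "\<bar>k * (cos (u s / 2) * (2 * cos (u s / 2) - b s))\<bar> \<le> 3 * k" for s
    proof -
      have "\<bar>2 * cos (u s / 2) - b s\<bar> \<le> 3"
        using b[of s] abs_cos_le_one[of "u s / 2"] by linarith
      then have "\<bar>cos (u s / 2)\<bar> * \<bar>2 * cos (u s / 2) - b s\<bar> \<le> 1 * 3"
        by (intro mult_mono) auto
      then show ?thesis
        using \<open>k > 0\<close> by (simp add: abs_mult)
    qed
    show "sin (u 0 / 2) \<noteq> 0"
      using u0 sin_gt_zero[of "u 0 / 2"] by auto
  qed fact
  \<comment> \<open>\<open>sin (u / 2)\<close> vanishes at both \<open>0\<close> and
    \<open>2 * pi\<close>, so \<open>u\<close> can reach neither end of the interval.\<close>
  have range: "0 < u t \<and> u t < 2 * pi" if "t \<ge> 0" for t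
  proof (rule continuous_avoiding_stays_between[where u = u and t = t])
    show "continuous_on {0..t} u"
      using cont by (rule continuous_on_subset) auto
    show "u s \<noteq> 0 \<and> u s \<noteq> 2 * pi" if "0 \<le> s" "s \<le> t" for s
      using sin_nz[OF that(1)] by auto
  qed (use that u0 in auto)
  have cos_lt: "cos (u t / 2) < 1" if "t \<ge> 0" for t
    using cos_monotone_0_pi[of 0 "u t / 2"] range[OF that] by simp
  \<comment> \<open>With \<open>c = cos (u/2)\<close> we have \<open>c' \<le> - k (1 - c\<^sup>2) (2 c - 1)\<close>. Passing to
    \<open>f = (c - 1/2) / (1 - c)\<close> turns this into \<open>f' \<le> - k (1 + c) f\<close>, and as \<open>f\<close> has the sign of
    \<open>c - 1/2\<close>, the factor \<open>1 + c\<close> may be replaced by \<open>3/2\<close> on both sides of \<open>2\<pi>/3\<close>.\<close>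
  define f where "f t = 1 / (2 * (1 - cos (u t / 2))) - 1" for t
  define f' where "f' t = - (k * (sin (u t / 2))\<^sup>2 * (2 * cos (u t / 2) - b t))
    / (2 * (1 - cos (u t / 2))\<^sup>2)" for t
  have f_decay: "f t \<le> f 0 * exp (- (3 / 2 * k) * t)" if "t \<ge> 0" for t
  proof (rule gronwall_exp_decay[where f' = f'])
    show "(f has_real_derivative f' s) (at s within {0..})" if "s \<ge> 0" for s
    proof -
      have nz: "1 - cos (u s / 2) \<noteq> 0"
        using cos_lt[OF that] by simp
      show ?thesis
        unfolding f_def f'_def using nz
        by (auto intro!: derivative_eq_intros deriv[OF that] simp: power2_eq_square)
          (simp add: divide_simps, simp add: algebra_simps)
    qed
    show "f' s \<le> - (3 / 2 * k) * f s" if "s \<ge> 0" for s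
    proof -
      define c where "c = cos (u s / 2)"
      have c: "c < 1" "-1 \<le> c"
        using cos_lt[OF that] by (auto simp: c_def)
      have "f' s = - (k * (1 - c\<^sup>2) / (2 * (1 - c)\<^sup>2)) * (2 * c - b s)"
        by (simp add: f'_def c_def sin_squared_eq)
      also have "k * (1 - c\<^sup>2) / (2 * (1 - c)\<^sup>2) = k * (1 + c) / (2 * (1 - c))"
        using c by (simp add: divide_simps) (simp add: algebra_simps power2_eq_square)
      also have "- (k * (1 + c) / (2 * (1 - c))) * (2 * c - b s)
          \<le> - (k * (1 + c) / (2 * (1 - c))) * (2 * c - 1)"
        using c \<open>k > 0\<close> b[of s] by (intro mult_left_mono_neg) auto
      \<comment> \<open>The left side is \<open>- k (1 + c) f\<close>. Splitting
        \<open>1 + c = 3/2 + (c - 1/2)\<close> isolates the desired rate, and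
        \<open>(c - 1/2) f\<close> is a square over a positive number.\<close>
      also have "\<dots> = - (3 / 2 * k) * f s - k * (2 * c - 1)\<^sup>2 / (4 * (1 - c))"
        unfolding f_def c_def[symmetric] using c
        by (simp add: divide_simps) (simp add: algebra_simps power2_eq_square)
      also have "\<dots> \<le> - (3 / 2 * k) * f s"
        using c \<open>k > 0\<close> by simp
      finally show ?thesis .
    qed
  qed fact
  \<comment> \<open>The factor 16 is \<open>2 * 4 * 2\<close>: from \<open>1 - c <= 2\<close>, from
    the constant in \<open>cos_minus_half_ge\<close>, and from passing from \<open>u / 2\<close> to
    \<open>u\<close>. The absolute value covers a negative \<open>f 0\<close>.\<close>
  have "2 * pi / 3 - 16 * \<bar>f 0\<bar> * exp (- (3 / 2 * k) * t) \<le> u t" if "t \<ge> 0" for t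
  proof -
    define E where "E = \<bar>f 0\<bar> * exp (- (3 / 2 * k) * t)"
    define c where "c = cos (u t / 2)"
    have c: "c < 1" "-1 \<le> c"
      using cos_lt[OF that] by (auto simp: c_def)
    have E: "0 \<le> E" "f t \<le> E"
      using order_trans[OF f_decay[OF that]
          mult_right_mono[of "f 0" "\<bar>f 0\<bar>" "exp (- (3 / 2 * k) * t)"]]
      by (auto simp: E_def)
    have "c - 1 / 2 = (1 - c) * f t"
      using c unfolding f_def c_def[symmetric] by (simp add: field_simps)
    also have "\<dots> \<le> (1 - c) * E"
      using E c by (intro mult_left_mono) auto
    also have "\<dots> \<le> 2 * E"
      using E c by (intro mult_right_mono) auto
    finally have "max 0 (c - 1 / 2) \<le> 2 * E"
      using E by simp
    moreover have "(pi / 3 - u t / 2) / 4 \<le> max 0 (c - 1 / 2)"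
      unfolding c_def using range[OF that] by (intro cos_minus_half_ge) auto
    ultimately have "(pi / 3 - u t / 2) / 4 \<le> 2 * E"
      by linarith
    then show ?thesis
      by (simp add: E_def algebra_simps)
  qed
  then show ?thesis
    by (intro exI[of _ "16 * \<bar>f 0\<bar>"]) auto
qed

section \<open>The cyclic system of three gaps\<close>

lemma splay_field_factor:
  fixes u v w :: real
  assumes "u + v + w = 2 * pi"
  shows "2 * sin u - sin v - sin w = 2 * sin (u / 2) * (2 * cos (u / 2) - cos ((v - w) / 2))"
proof -
  have "(v + w) / 2 = pi - u / 2"
    using assms by (simp add: field_simps)
  then have "sin v + sin w = 2 * sin (u / 2) * cos ((v - w) / 2)"
    by (simp only: sin_plus_sin sin_pi_minus)
  moreover have "sin u = 2 * sin (u / 2) * cos (u / 2)"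
    using sin_double[of "u / 2"] by simp
  ultimately show ?thesis
    by (simp add: algebra_simps)
qed

lemma splay_gap_lower_bound:
  fixes u v w :: "real \<Rightarrow> real"
  assumes "k > 0"
    and sum: "\<And>t. u t + v t + w t = 2 * pi"
    and deriv: "\<And>t. t \<ge> 0 \<Longrightarrow>
      (u has_real_derivative k * (2 * sin (u t) - sin (v t) - sin (w t))) (at t within {0..})"
    and "0 < u 0" "0 < v 0" "0 < w 0"
  shows "\<exists>C\<ge>0. \<forall>t\<ge>0. 2 * pi / 3 - C * exp (- (3 / 2 * k) * t) \<le> u t"
proof (rule phase_gap_lower_bound[where b = "\<lambda>t. cos ((v t - w t) / 2)"])
  show "(u has_real_derivative 2 * k * sin (u t / 2) * (2 * cos (u t / 2) - cos ((v t - w t) / 2)))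
      (at t within {0..})" if "t \<ge> 0" for t
    using deriv[OF that] unfolding splay_field_factor[OF sum] by (simp add: ac_simps)
  show "u 0 < 2 * pi"
    using sum[of 0] assms(4-6) by simp
qed (use assms in auto)

lemma splay_convergence:
  fixes u v w :: "real \<Rightarrow> real"
  assumes "k > 0"
    and sum: "\<And>t. u t + v t + w t = 2 * pi"
    and du: "\<And>t. t \<ge> 0 \<Longrightarrow>
      (u has_real_derivative k * (2 * sin (u t) - sin (v t) - sin (w t))) (at t within {0..})"
    and dv: "\<And>t. t \<ge> 0 \<Longrightarrow>
      (v has_real_derivative k * (2 * sin (v t) - sin (w t) - sin (u t))) (at t within {0..})"
    and dw: "\<And>t. t \<ge> 0 \<Longrightarrow>
      (w has_real_derivative k * (2 * sin (w t) - sin (u t) - sin (v t))) (at t within {0..})"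
    and pos: "0 < u 0" "0 < v 0" "0 < w 0"
  shows "\<exists>C r. C \<ge> 0 \<and> r > 0 \<and> (\<forall>t\<ge>0. \<bar>u t - 2 * pi / 3\<bar> \<le> C * exp (- r * t) \<and>
    \<bar>v t - 2 * pi / 3\<bar> \<le> C * exp (- r * t) \<and> \<bar>w t - 2 * pi / 3\<bar> \<le> C * exp (- r * t))"
proof -
  have sums: "v t + w t + u t = 2 * pi" "w t + u t + v t = 2 * pi" for t
    using sum[of t] by auto
  obtain A where A: "A \<ge> 0" "\<And>t. t \<ge> 0 \<Longrightarrow> 2 * pi / 3 - A * exp (- (3 / 2 * k) * t) \<le> u t"
    using splay_gap_lower_bound[OF \<open>k > 0\<close> sum du pos] by blast
  obtain B where B: "B \<ge> 0" "\<And>t. t \<ge> 0 \<Longrightarrow> 2 * pi / 3 - B * exp (- (3 / 2 * k) * t) \<le> v t"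
    using splay_gap_lower_bound[OF \<open>k > 0\<close> sums(1) dv pos(2,3,1)] by blast
  obtain C where C: "C \<ge> 0" "\<And>t. t \<ge> 0 \<Longrightarrow> 2 * pi / 3 - C * exp (- (3 / 2 * k) * t) \<le> w t"
    using splay_gap_lower_bound[OF \<open>k > 0\<close> sums(2) dw pos(3,1,2)] by blast
  \<comment> \<open>The deficit of each gap costs its own constant, and its excess equals the total
    deficit of the other two, so \<open>A + B + C\<close> serves all six bounds.\<close>
  have "\<bar>u t - 2 * pi / 3\<bar> \<le> (A + B + C) * exp (- (3 / 2 * k) * t) \<and>
      \<bar>v t - 2 * pi / 3\<bar> \<le> (A + B + C) * exp (- (3 / 2 * k) * t) \<and>
      \<bar>w t - 2 * pi / 3\<bar> \<le> (A + B + C) * exp (- (3 / 2 * k) * t)" if "t \<ge> 0" for t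
  proof -
    define E where "E = exp (- (3 / 2 * k) * t)"
    have "0 \<le> A * E" "0 \<le> B * E" "0 \<le> C * E"
      using A(1) B(1) C(1) by (auto simp: E_def)
    moreover have "2 * pi / 3 - A * E \<le> u t" "2 * pi / 3 - B * E \<le> v t" "2 * pi / 3 - C * E \<le> w t"
      using A(2) B(2) C(2) that by (auto simp: E_def)
    moreover have "(A + B + C) * E = A * E + B * E + C * E"
      by (simp add: algebra_simps)
    ultimately show ?thesis
      unfolding E_def[symmetric] using sum[of t] by linarith
  qed
  moreover have "3 / 2 * k > 0" "A + B + C \<ge> 0"
    using \<open>k > 0\<close> A B C by auto
  ultimately show ?thesis
    by blast
qed

section \<open>Back to the phases\<close>

text \<open>Swapping \<open>i\<close> and \<open>j\<close> only changes a sign inside the absolute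
  value, and for \<open>i = j\<close> the left side is 0, so three pairs suffice.\<close>

lemma converges_exponentially_to_modeI:
  fixes \<Theta> :: "real \<Rightarrow> real ^ 3"
  assumes "C \<ge> 0" "r > 0"
    and "\<And>t. t \<ge> 0 \<Longrightarrow> \<bar>(\<Theta> t $ 1 - \<Theta> t $ 2) - (\<Phi> $ 1 - \<Phi> $ 2)\<bar> \<le> C * exp (- r * t)"
    and "\<And>t. t \<ge> 0 \<Longrightarrow> \<bar>(\<Theta> t $ 1 - \<Theta> t $ 3) - (\<Phi> $ 1 - \<Phi> $ 3)\<bar> \<le> C * exp (- r * t)"
    and "\<And>t. t \<ge> 0 \<Longrightarrow> \<bar>(\<Theta> t $ 2 - \<Theta> t $ 3) - (\<Phi> $ 2 - \<Phi> $ 3)\<bar> \<le> C * exp (- r * t)"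
  shows "converges_exponentially_to_mode \<Theta> \<Phi>"
proof -
  have "\<bar>(\<Theta> t $ i - \<Theta> t $ j) - (\<Phi> $ i - \<Phi> $ j)\<bar> \<le> C * exp (- r * t)" if "t \<ge> 0" for i j t
  proof -
    have "0 \<le> C * exp (- r * t)"
      using \<open>C \<ge> 0\<close> by simp
    then show ?thesis
      using exhaust_3[of i] exhaust_3[of j] assms(3-5)[OF that] by (elim disjE) (simp_all add: abs_le_iff)
  qed
  with assms(1,2) show ?thesis
    unfolding converges_exponentially_to_mode_def by blast
qed

lemma kuramoto3_solution_component_deriv:
  assumes "kuramoto3_solution K1 K2 \<Theta>" "t \<ge> 0"
  shows "((\<lambda>t. \<Theta> t $ i) has_real_derivative kuramoto3_field K1 K2 (\<Theta> t) $ i) (at t within {0..})"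
  using assms bounded_linear.has_vector_derivative[OF bounded_linear_vec_nth]
  unfolding kuramoto3_solution_def has_real_derivative_iff_has_vector_derivative by blast

theorem theorem1:
  fixes K1 K2 :: real and \<Theta> :: "real \<Rightarrow> real ^ 3"
  assumes "K1 = - K2" and "K1 < 0"
    and "kuramoto3_solution K1 K2 \<Theta>"
  shows
    "(- pi < \<Theta> 0 $ 1 - \<Theta> 0 $ 3 \<and> \<Theta> 0 $ 1 - \<Theta> 0 $ 3 < pi / 3 \<and>
      - (pi / 3) < \<Theta> 0 $ 2 - \<Theta> 0 $ 3 \<and> \<Theta> 0 $ 2 - \<Theta> 0 $ 3 < pi \<and>
      - (4 * pi / 3) < \<Theta> 0 $ 1 - \<Theta> 0 $ 2 \<and> \<Theta> 0 $ 1 - \<Theta> 0 $ 2 < 0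
      \<longrightarrow> converges_exponentially_to_mode \<Theta> (vector [0, 2 * pi / 3, pi / 3])) \<and>
     (- (7 * pi / 3) < \<Theta> 0 $ 1 - \<Theta> 0 $ 3 \<and> \<Theta> 0 $ 1 - \<Theta> 0 $ 3 < - pi \<and>
      - pi < \<Theta> 0 $ 2 - \<Theta> 0 $ 3 \<and> \<Theta> 0 $ 2 - \<Theta> 0 $ 3 < pi / 3 \<and>
      - (2 * pi) < \<Theta> 0 $ 1 - \<Theta> 0 $ 2 \<and> \<Theta> 0 $ 1 - \<Theta> 0 $ 2 < - (2 * pi / 3)
      \<longrightarrow> converges_exponentially_to_mode \<Theta> (vector [0, 4 * pi / 3, 5 * pi / 3]))"
proof (intro conjI impI; elim conjE)
  define k where "k = K2 / 3"
  have k: "k > 0" "K1 / 3 = - k" "K2 / 3 = k"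
    using assms(1,2) by (auto simp: k_def)
  \<comment> \<open>Orienting all sine arguments as 3-1, 3-2 and 2-1 makes every derivative a linear
    combination of the same three sines.\<close>
  note sin_flip = sin_minus[of "\<Theta> t $ i - \<Theta> t $ j" for i j t, unfolded minus_diff_eq]
  have d1: "((\<lambda>t. \<Theta> t $ 1) has_real_derivative
      k * (sin (\<Theta> t $ 3 - \<Theta> t $ 1) - sin (\<Theta> t $ 2 - \<Theta> t $ 1))) (at t within {0..})"
    and d2: "((\<lambda>t. \<Theta> t $ 2) has_real_derivative
      k * (sin (\<Theta> t $ 3 - \<Theta> t $ 2) + sin (\<Theta> t $ 2 - \<Theta> t $ 1))) (at t within {0..})"
    and d3: "((\<lambda>t. \<Theta> t $ 3) has_real_derivative
      k * (- sin (\<Theta> t $ 3 - \<Theta> t $ 1) - sin (\<Theta> t $ 3 - \<Theta> t $ 2))) (at t within {0..})"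
    if "t \<ge> 0" for t
    using kuramoto3_solution_component_deriv[OF assms(3) that, of 1]
      kuramoto3_solution_component_deriv[OF assms(3) that, of 2]
      kuramoto3_solution_component_deriv[OF assms(3) that, of 3]
      sin_flip[of t 3 1] sin_flip[of t 3 2] sin_flip[of t 2 1]
    by (simp_all add: kuramoto3_field_def k algebra_simps)
  {
    assume init: "- pi < \<Theta> 0 $ 1 - \<Theta> 0 $ 3" "\<Theta> 0 $ 2 - \<Theta> 0 $ 3 < pi" "\<Theta> 0 $ 1 - \<Theta> 0 $ 2 < 0"
    \<comment> \<open>Shifting phase 3 by \<open>pi\<close> reverses the sign of its couplings, so
      that all three oscillators repel each other equally. The gaps \<open>u\<close>,
      \<open>w\<close>, \<open>v\<close> lie between consecutive points of
      \<open>theta_3 - pi\<close>, \<open>theta_1\<close>, \<open>theta_2\<close>,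
      \<open>theta_3 + pi\<close>; the initial conditions say that these are in increasing
      order.\<close>
    define u where "u t = pi - (\<Theta> t $ 3 - \<Theta> t $ 1)" for t
    define v where "v t = (\<Theta> t $ 3 - \<Theta> t $ 2) + pi" for t
    define w where "w t = \<Theta> t $ 2 - \<Theta> t $ 1" for t
    have "\<exists>C r. C \<ge> 0 \<and> r > 0 \<and> (\<forall>t\<ge>0. \<bar>u t - 2 * pi / 3\<bar> \<le> C * exp (- r * t) \<and>
        \<bar>v t - 2 * pi / 3\<bar> \<le> C * exp (- r * t) \<and> \<bar>w t - 2 * pi / 3\<bar> \<le> C * exp (- r * t))"
    proof (rule splay_convergence[OF k(1)])
      show "u t + v t + w t = 2 * pi" for t
        by (simp add: u_def v_def w_def)
      show "0 < u 0" "0 < v 0" "0 < w 0"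
        using init by (auto simp: u_def v_def w_def)
      fix t :: real assume "t \<ge> 0"
      note [derivative_intros] = d1[OF this] d2[OF this] d3[OF this]
      show "(u has_real_derivative k * (2 * sin (u t) - sin (v t) - sin (w t))) (at t within {0..})"
        unfolding u_def v_def w_def sin_pi_minus sin_periodic_pi
        by (rule derivative_eq_intros refl)+ (simp add: algebra_simps)
      show "(v has_real_derivative k * (2 * sin (v t) - sin (w t) - sin (u t))) (at t within {0..})"
        unfolding u_def v_def w_def sin_pi_minus sin_periodic_pi
        by (rule derivative_eq_intros refl)+ (simp add: algebra_simps)
      show "(w has_real_derivative k * (2 * sin (w t) - sin (u t) - sin (v t))) (at t within {0..})"
        unfolding u_def v_def w_def sin_pi_minus sin_periodic_pi
        by (rule derivative_eq_intros refl)+ (simp add: algebra_simps)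
    qed
    then obtain C r where Cr: "C \<ge> 0" "r > 0"
      and bd: "\<And>t. t \<ge> 0 \<Longrightarrow> \<bar>u t - 2 * pi / 3\<bar> \<le> C * exp (- r * t)"
        "\<And>t. t \<ge> 0 \<Longrightarrow> \<bar>v t - 2 * pi / 3\<bar> \<le> C * exp (- r * t)"
        "\<And>t. t \<ge> 0 \<Longrightarrow> \<bar>w t - 2 * pi / 3\<bar> \<le> C * exp (- r * t)"
      by blast
    show "converges_exponentially_to_mode \<Theta> (vector [0, 2 * pi / 3, pi / 3])"
    proof (rule converges_exponentially_to_modeI[OF Cr], goal_cases)
      case (1 t) then show ?case using bd(3)[of t] by (simp add: w_def abs_le_iff)
    next
      case (2 t) then show ?case using bd(1)[of t] by (simp add: u_def abs_le_iff)
    next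
      case (3 t) then show ?case using bd(2)[of t] by (simp add: v_def abs_le_iff)
    qed
  }
  {
    assume init: "\<Theta> 0 $ 1 - \<Theta> 0 $ 3 < - pi" "- pi < \<Theta> 0 $ 2 - \<Theta> 0 $ 3"
      "- (2 * pi) < \<Theta> 0 $ 1 - \<Theta> 0 $ 2"
    \<comment> \<open>The opposite cyclic order: \<open>u\<close>, \<open>v\<close>,
      \<open>w\<close> are the gaps along \<open>theta_1\<close>, \<open>theta_3 - pi\<close>,
      \<open>theta_2\<close>, \<open>theta_1 + 2 pi\<close>.\<close>
    define u where "u t = (\<Theta> t $ 3 - \<Theta> t $ 1) - pi" for t
    define v where "v t = pi - (\<Theta> t $ 3 - \<Theta> t $ 2)" for t
    define w where "w t = 2 * pi - (\<Theta> t $ 2 - \<Theta> t $ 1)" for t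
    have sin_minus_pi: "sin (x - pi) = - sin x" for x :: real
      by (simp add: sin_diff)
    have "\<exists>C r. C \<ge> 0 \<and> r > 0 \<and> (\<forall>t\<ge>0. \<bar>u t - 2 * pi / 3\<bar> \<le> C * exp (- r * t) \<and>
        \<bar>v t - 2 * pi / 3\<bar> \<le> C * exp (- r * t) \<and> \<bar>w t - 2 * pi / 3\<bar> \<le> C * exp (- r * t))"
    proof (rule splay_convergence[OF k(1)])
      show "u t + v t + w t = 2 * pi" for t
        by (simp add: u_def v_def w_def)
      show "0 < u 0" "0 < v 0" "0 < w 0"
        using init by (auto simp: u_def v_def w_def)
      fix t :: real assume "t \<ge> 0"
      note [derivative_intros] = d1[OF this] d2[OF this] d3[OF this]
      show "(u has_real_derivative k * (2 * sin (u t) - sin (v t) - sin (w t))) (at t within {0..})"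
        unfolding u_def v_def w_def sin_pi_minus sin_minus_pi sin_2pi_minus
        by (rule derivative_eq_intros refl)+ (simp add: algebra_simps)
      show "(v has_real_derivative k * (2 * sin (v t) - sin (w t) - sin (u t))) (at t within {0..})"
        unfolding u_def v_def w_def sin_pi_minus sin_minus_pi sin_2pi_minus
        by (rule derivative_eq_intros refl)+ (simp add: algebra_simps)
      show "(w has_real_derivative k * (2 * sin (w t) - sin (u t) - sin (v t))) (at t within {0..})"
        unfolding u_def v_def w_def sin_pi_minus sin_minus_pi sin_2pi_minus
        by (rule derivative_eq_intros refl)+ (simp add: algebra_simps)
    qed
    then obtain C r where Cr: "C \<ge> 0" "r > 0"
      and bd: "\<And>t. t \<ge> 0 \<Longrightarrow> \<bar>u t - 2 * pi / 3\<bar> \<le> C * exp (- r * t)"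
        "\<And>t. t \<ge> 0 \<Longrightarrow> \<bar>v t - 2 * pi / 3\<bar> \<le> C * exp (- r * t)"
        "\<And>t. t \<ge> 0 \<Longrightarrow> \<bar>w t - 2 * pi / 3\<bar> \<le> C * exp (- r * t)"
      by blast
    show "converges_exponentially_to_mode \<Theta> (vector [0, 4 * pi / 3, 5 * pi / 3])"
    \<comment> \<open>The differences 1-2, 1-3, 2-3 are \<open>w - 2 pi\<close>,
      \<open>- u - pi\<close>, \<open>v - pi\<close>, and gaps of \<open>2 pi / 3\<close> give those
      of the mode exactly, not only modulo \<open>2 pi\<close>.\<close>
    proof (rule converges_exponentially_to_modeI[OF Cr], goal_cases)
      case (1 t) then show ?case using bd(3)[of t] by (simp add: w_def abs_le_iff)
    next
      case (2 t) then show ?case using bd(1)[of t] by (simp add: u_def abs_le_iff)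
    next
      case (3 t) then show ?case using bd(2)[of t] by (simp add: v_def abs_le_iff)
    qed
  }
qed

end
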